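(* Let $d\geq 1$ and let $c$ be the squarefree part of $d$ (the product of the distinct primes dividing $d$). Then every cyclotomic factor of $M_d(x)$ is induced from a cyclotomic factor of $M_c(x)$: that is, if $\Phi_m(x)$ divides $M_d(x)$, then there is $n\geq 1$ such that $\Phi_n(x)$ divides $M_c(x)$ and $\Phi_m(x)$ divides $\Phi_n(x^{d/c})$.
   Context: $M_d(x)=\frac1d\sum_{e\mid d}\mu(e)x^{d/e}\in\mathbb{Q}[x]$ is the $d$th necklace polynomial ($\mu$ the Möbius function), and $\Phi_m(x)$ is the $m$th cyclotomic polynomial. *)

theory Defs
  imports
    Complex_Main
    "HOL-Computational_Algebra.Computational_Algebra"
begin

definition moebius :: "nat \<Rightarrow> int" where
  "moebius n = (if squarefree n then (-1) ^ card (prime_factors n) else 0)"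

definition necklace_poly :: "nat \<Rightarrow> rat poly" where
  "necklace_poly d =
     smult (1 / of_nat d) (\<Sum>e | e dvd d. smult (of_int (moebius e)) (monom 1 (d div e)))"

definition primitive_roots_unity :: "nat \<Rightarrow> complex set" where
  "primitive_roots_unity m = {z. z ^ m = 1 \<and> (\<forall>k. 0 < k \<and> k < m \<longrightarrow> z ^ k \<noteq> 1)}"

(* The polynomial over the rationals whose image in \<complex>[x] is the product of x - \<zeta> over the
   primitive m-th roots of unity; the lemma map_poly_cyclotomic_poly below shows that it exists.
   The value at m = 0 has no meaning. *)
definition cyclotomic_poly :: "nat \<Rightarrow> rat poly" where
  "cyclotomic_poly m =
     (THE p. map_poly of_rat p = (\<Prod>z\<in>primitive_roots_unity m. [:-z, 1:]))"

lemma of_rat_poly_mult: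
  "map_poly (of_rat :: rat \<Rightarrow> complex) (p * q) = map_poly of_rat p * map_poly of_rat q"
  by (intro poly_eqI) (simp add: coeff_map_poly coeff_mult of_rat_sum of_rat_mult)

lemma of_rat_poly_add:
  "map_poly (of_rat :: rat \<Rightarrow> complex) (p + q) = map_poly of_rat p + map_poly of_rat q"
  by (intro poly_eqI) (simp add: coeff_map_poly of_rat_add)

lemma of_rat_poly_prod:
  "map_poly (of_rat :: rat \<Rightarrow> complex) (\<Prod>i\<in>A. f i) = (\<Prod>i\<in>A. map_poly of_rat (f i))"
  by (induction A rule: infinite_finite_induct) (simp_all add: of_rat_poly_mult)

lemma of_rat_poly_inj:
  assumes "map_poly (of_rat :: rat \<Rightarrow> complex) p = map_poly of_rat q"
  shows "p = q"
proof (rule poly_eqI)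
  fix i
  have "of_rat (coeff p i) = (of_rat (coeff q i) :: complex)"
    using arg_cong[OF assms, of "\<lambda>r. coeff r i"] by (simp add: coeff_map_poly)
  then show "coeff p i = coeff q i" by simp
qed

lemma prod_roots_unity:
  assumes "n > 0"
  shows "(\<Prod>z | z ^ n = 1. [:-z, 1:]) = monom 1 n - (1 :: complex poly)"
proof -
  let ?p = "monom 1 n - (1 :: complex poly)"
  have ev: "poly ?p z = z ^ n - 1" for z by (simp add: poly_monom)
  have deg: "degree ?p = n"
    using degree_add_eq_left[of "-1 :: complex poly" "monom 1 n"] assms by (simp add: degree_monom_eq)
  have lead: "lead_coeff ?p = 1" unfolding deg using assms by simp
  have "rsquarefree ?p"
    unfolding rsquarefree_roots using assms
    by (auto simp: ev pderiv_diff pderiv_monom poly_monom power_0_left)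
  from complex_poly_decompose_rsquarefree[OF this] show ?thesis
    unfolding lead ev by simp
qed

lemma roots_unity_conv_primitive:
  assumes "n > 0"
  shows "{z :: complex. z ^ n = 1} = (\<Union>d\<in>{d. d dvd n}. primitive_roots_unity d)"
proof (intro equalityI subsetI)
  fix z :: complex assume "z \<in> {z. z ^ n = 1}"
  then have z: "z ^ n = 1" by simp
  define k where "k = (LEAST k. 0 < k \<and> z ^ k = 1)"
  have k: "0 < k" "z ^ k = 1"
    using LeastI[of "\<lambda>k. 0 < k \<and> z ^ k = 1" n] z assms unfolding k_def by auto
  have least: "z ^ j \<noteq> 1" if "0 < j" "j < k" for j
    using not_less_Least[of j "\<lambda>k. 0 < k \<and> z ^ k = 1"] that unfolding k_def by auto
  have "z ^ n = z ^ (k * (n div k) + n mod k)" by simp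
  also have "\<dots> = z ^ (n mod k)" unfolding power_add power_mult k(2) by simp
  finally have "z ^ (n mod k) = 1" using z by simp
  then have "n mod k = 0" using least[of "n mod k"] k by (metis mod_less_divisor neq0_conv)
  then show "z \<in> (\<Union>d\<in>{d. d dvd n}. primitive_roots_unity d)"
    using k least by (auto simp: primitive_roots_unity_def)
qed (auto simp: primitive_roots_unity_def power_mult)

lemma cyclotomic_rational:
  "n > 0 \<Longrightarrow> \<exists>p. map_poly of_rat p = (\<Prod>z\<in>primitive_roots_unity n. [:-z, 1:])"
proof (induction n rule: less_induct)
  case (less n)
  let ?C = "\<lambda>n. \<Prod>z\<in>primitive_roots_unity n. [:-z, 1:]"
  let ?h = "map_poly (of_rat :: rat \<Rightarrow> complex)"
  let ?D = "{d. d dvd n} - {n}"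
  have fin: "finite {d. d dvd n}" using less.prems by simp
  have pos: "d > 0" if "d dvd n" for d using less.prems that by (rule dvd_pos_nat)
  have "\<forall>d\<in>?D. \<exists>p. ?h p = ?C d"
    using less.IH pos dvd_imp_le[OF _ less.prems] by (metis DiffE mem_Collect_eq le_neq_implies_less singletonI)
  then obtain f where f: "?h (f d) = ?C d" if "d \<in> ?D" for d by metis
  define g where "g = (\<Prod>d\<in>?D. f d)"
  have hg: "?h g = (\<Prod>d\<in>?D. ?C d)"
    unfolding g_def of_rat_poly_prod using f by (intro prod.cong) auto
  have "?C d \<noteq> 0" for d
    by (cases "finite (primitive_roots_unity d)") auto
  then have g0: "?h g \<noteq> 0"
    unfolding hg using fin by auto
  have sub: "primitive_roots_unity d \<subseteq> {z. z ^ n = 1}" if "d dvd n" for d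
    using roots_unity_conv_primitive[OF less.prems] that by auto
  have finr: "finite (primitive_roots_unity d)" if "d dvd n" for d
    using finite_subset[OF sub[OF that]] finite_roots_unity less.prems by auto
  have disj: "primitive_roots_unity a \<inter> primitive_roots_unity b = {}"
    if "a > 0" "b > 0" "a \<noteq> b" for a b
    using that by (auto simp: primitive_roots_unity_def) (metis linorder_neqE_nat)
  have "monom 1 n - 1 = (\<Prod>z | z ^ n = (1::complex). [:-z, 1:])"
    using prod_roots_unity[OF less.prems] by simp
  also have "\<dots> = (\<Prod>d | d dvd n. ?C d)"
    unfolding roots_unity_conv_primitive[OF less.prems]
    using fin finr disj pos by (intro prod.UNION_disjoint) auto
  also have "\<dots> = ?C n * ?h g"
    unfolding hg using fin by (subst prod.remove[of _ n]) auto
  finally have eq: "monom 1 n - 1 = ?C n * ?h g" .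
  define P :: "rat poly" where "P = monom 1 n - 1"
  have hP: "?h P = ?C n * ?h g"
    unfolding eq[symmetric] P_def by (intro poly_eqI) (simp add: coeff_map_poly of_rat_diff)
  define q r where "q = P div g" and "r = P mod g"
  have "?h P = ?h (q * g + r)" unfolding q_def r_def by simp
  then have rr: "?h r = (?C n - ?h q) * ?h g"
    using hP by (simp add: of_rat_poly_add of_rat_poly_mult algebra_simps)
  have dh: "degree (?h p) = degree p" for p by (rule degree_map_poly) auto
  have "g \<noteq> 0" using g0 by auto
  have "?C n - ?h q = 0"
  proof (rule ccontr)
    assume ne: "?C n - ?h q \<noteq> 0"
    then have "r \<noteq> 0" using rr g0 by auto
    moreover have "degree r \<ge> degree g"
      using arg_cong[OF rr, of degree] ne g0 by (simp add: dh degree_mult_eq)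
    ultimately show False
      using degree_mod_less[OF \<open>g \<noteq> 0\<close>, of P] by (auto simp: r_def)
  qed
  then show ?case by (intro exI[of _ q]) simp
qed

lemma map_poly_cyclotomic_poly:
  assumes "m > 0"
  shows "map_poly of_rat (cyclotomic_poly m) = (\<Prod>z\<in>primitive_roots_unity m. [:-z, 1:])"
  unfolding cyclotomic_poly_def
proof (rule theI')
  show "\<exists>!p. map_poly of_rat p = (\<Prod>z\<in>primitive_roots_unity m. [:-z, 1:])"
    using cyclotomic_rational[OF assms] of_rat_poly_inj by metis
qed

end

theory Submission
  imports Defs
begin

text \<open>
  Since the Moebius function vanishes off the squarefree numbers, $M_d(x)$ is a scalar multiple of
  $M_c(x^k)$ with $k = d/c$. If $\zeta$ runs over the primitive $m$-th roots of unity, $\zeta^k$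
  runs over all primitive $n$-th roots of unity for $n = m / \gcd(m,k)$, because units modulo $n$
  lift to units modulo $m$. Hence $\Phi_m(x)$ divides $\Phi_n(x^k)$, and if $\Phi_m$ divides
  $M_c(x^k)$, then every primitive $n$-th root of unity is a root of $M_c$.
\<close>

section \<open>Divisibility over the rationals and complex roots\<close>

abbreviation complex_poly :: "rat poly \<Rightarrow> complex poly" where
  "complex_poly \<equiv> map_poly of_rat"

text \<open>Division with remainder in \<rat>[x] stays one over \<complex>, with all degrees
  unchanged. A remainder of degree below \<open>degree q\<close> whose image is divisible by that of
  \<open>q\<close> has to vanish.\<close>

lemma complex_poly_dvd_iff: "complex_poly q dvd complex_poly p \<longleftrightarrow> q dvd p"
proof
  assume dvd: "complex_poly q dvd complex_poly p"
  have deg: "degree (complex_poly r) = degree r" for r by (rule degree_map_poly) auto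
  show "q dvd p"
  proof (cases "q = 0")
    case True
    with dvd show ?thesis using of_rat_poly_inj[of p 0] by simp
  next
    case False
    have "complex_poly p = complex_poly q * complex_poly (p div q) + complex_poly (p mod q)"
      by (simp flip: of_rat_poly_mult of_rat_poly_add)
    with dvd have "complex_poly q dvd complex_poly (p mod q)"
      by (simp add: dvd_add_right_iff)
    then have "complex_poly (p mod q) = 0 \<or> degree q \<le> degree (p mod q)"
      using dvd_imp_degree_le deg by metis
    moreover have "p mod q = 0 \<or> degree (p mod q) < degree q"
      using degree_mod_less[OF False] .
    ultimately have "p mod q = 0"
      using of_rat_poly_inj[of "p mod q" 0] by auto
    then show ?thesis by auto
  qed
qed (auto simp: of_rat_poly_mult)

lemma poly_complex_poly_pcompose:
  "poly (complex_poly (pcompose p q)) z = poly (complex_poly p) (poly (complex_poly q) z)"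
  by (induction p)
     (simp_all add: pcompose_pCons of_rat_poly_add of_rat_poly_mult map_poly_pCons)

lemma prod_linear_factors_dvd_iff:
  fixes p :: "'a::field poly"
  assumes "finite A"
  shows "(\<Prod>z\<in>A. [:-z, 1:]) dvd p \<longleftrightarrow> (\<forall>z\<in>A. poly p z = 0)"
  using assms
proof (induction A arbitrary: p rule: finite_induct)
  case (insert a A)
  show ?case
  proof
    assume dvd: "(\<Prod>z\<in>insert a A. [:-z, 1:]) dvd p"
    show "\<forall>z\<in>insert a A. poly p z = 0"
    proof
      fix z assume "z \<in> insert a A"
      then have "[:-z, 1:] dvd (\<Prod>z\<in>insert a A. [:-z, 1:])"
        using insert.hyps by (intro dvd_prodI) auto
      with dvd show "poly p z = 0" unfolding poly_eq_0_iff_dvd by (blast intro: dvd_trans)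
    qed
  next
    assume roots: "\<forall>z\<in>insert a A. poly p z = 0"
    then obtain q where q: "p = [:-a, 1:] * q"
      by (metis insertI1 poly_eq_0_iff_dvd dvdE)
    have "poly q z = 0" if "z \<in> A" for z
    proof -
      \<comment> \<open>The factor \<open>z - a\<close> is nonzero, so the root \<open>z\<close> of
        \<open>p\<close> must come from the cofactor \<open>q\<close>.\<close>
      have "poly p z = 0" "z \<noteq> a" using roots that insert.hyps by auto
      then show ?thesis unfolding q by (simp del: mult_pCons_left)
    qed
    then have "(\<Prod>z\<in>A. [:-z, 1:]) dvd q" using insert.IH by blast
    then show "(\<Prod>z\<in>insert a A. [:-z, 1:]) dvd p"
      unfolding q using insert.hyps by (simp add: mult_dvd_mono del: mult_pCons_left)
  qed
qed simp

lemma finite_primitive_roots_unity: "m > 0 \<Longrightarrow> finite (primitive_roots_unity m)"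
  by (rule finite_subset[of _ "{z. z ^ m = 1}"])
     (auto simp: primitive_roots_unity_def intro!: finite_roots_unity)

text \<open>Over \<complex> the cyclotomic polynomial splits into distinct linear factors. This
  turns every divisibility in the theorem into a statement about values at roots of unity.\<close>

lemma cyclotomic_poly_dvd_iff:
  assumes "m > 0"
  shows "cyclotomic_poly m dvd p \<longleftrightarrow>
           (\<forall>z\<in>primitive_roots_unity m. poly (complex_poly p) z = 0)"
  using complex_poly_dvd_iff[of "cyclotomic_poly m" p]
    prod_linear_factors_dvd_iff[OF finite_primitive_roots_unity[OF assms]]
  by (simp add: map_poly_cyclotomic_poly[OF assms])

section \<open>Orders and powers of roots of unity\<close>

lemma primitive_roots_unity_iff:
  assumes "m > 0"
  shows "z \<in> primitive_roots_unity m \<longleftrightarrow> (\<forall>j. z ^ j = 1 \<longleftrightarrow> m dvd j)"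
proof
  assume z: "z \<in> primitive_roots_unity m"
  show "\<forall>j. z ^ j = 1 \<longleftrightarrow> m dvd j"
  proof
    fix j
    \<comment> \<open>Only \<open>j mod m\<close> matters; being less than \<open>m\<close>, it can
      give the value 1 only if it is 0.\<close>
    have "z ^ j = z ^ (m * (j div m) + j mod m)" by simp
    also have "\<dots> = z ^ (j mod m)"
      unfolding power_add power_mult using z by (simp add: primitive_roots_unity_def)
    finally show "z ^ j = 1 \<longleftrightarrow> m dvd j"
      using z assms mod_less_divisor[OF assms, of j]
      by (auto simp: primitive_roots_unity_def dvd_eq_mod_eq_0)
  qed
qed (auto simp: primitive_roots_unity_def dest: dvd_imp_le)

lemma cis_in_primitive_roots_unity:
  assumes "m > 0"
  shows "cis (2 * pi / real m) \<in> primitive_roots_unity m"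
proof -
  have pow: "cis (2 * pi / real m) ^ k = cis (2 * pi * real k / real m)" for k
    by (simp add: Complex.DeMoivre mult_ac)
  have inj: "inj_on (\<lambda>k. cis (2 * pi * real k / real m)) {..<m}"
    using bij_betw_roots_unity[OF assms] by (rule bij_betw_imp_inj_on)
  \<comment> \<open>Injectivity is applied against exponent 0, where the value is 1.\<close>
  have "cis (2 * pi / real m) ^ k \<noteq> 1" if "0 < k" "k < m" for k
    using inj_onD[OF inj, of k 0] that unfolding pow by auto
  moreover have "cis (2 * pi / real m) ^ m = 1" unfolding pow using assms by simp
  ultimately show ?thesis by (auto simp: primitive_roots_unity_def)
qed

text \<open>A counting argument: the powers of \<open>w\<close> with exponents below
  \<open>n\<close> are distinct, and there are only \<open>n\<close> roots of \<open>x^n - 1\<close>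
  for them to fill.\<close>

lemma root_unity_eq_power:
  assumes "n > 0" "w \<in> primitive_roots_unity n" "z ^ n = 1"
  obtains j where "z = w ^ j"
proof -
  have "w ^ n = 1" "w \<noteq> 0"
    using assms by (auto simp: primitive_roots_unity_def power_0_left split: if_splits)
  have "inj_on (\<lambda>j. w ^ j) {..<n}"
  proof (rule linorder_inj_onI')
    fix i j assume ij: "i \<in> {..<n}" "j \<in> {..<n}" "i < j"
    then have "w ^ j = w ^ i * w ^ (j - i)" by (simp flip: power_add)
    moreover have "w ^ (j - i) \<noteq> 1"
      using assms(2) ij by (auto simp: primitive_roots_unity_def)
    ultimately show "w ^ i \<noteq> w ^ j" using \<open>w \<noteq> 0\<close> by simp
  qed
  then have "card ((\<lambda>j. w ^ j) ` {..<n}) = n" by (simp add: card_image)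
  moreover have "(\<lambda>j. w ^ j) ` {..<n} \<subseteq> {z. z ^ n = 1}"
    using \<open>w ^ n = 1\<close> by auto (metis power_mult mult.commute power_one)
  moreover have "card {z :: complex. z ^ n = 1} = n" "finite {z :: complex. z ^ n = 1}"
    using card_roots_unity_eq[OF assms(1)] finite_roots_unity[of n] assms(1) by auto
  ultimately have "(\<lambda>j. w ^ j) ` {..<n} = {z. z ^ n = 1}"
    by (metis card_subset_eq)
  with assms(3) have "z \<in> (\<lambda>j. w ^ j) ` {..<n}" by simp
  with that show ?thesis by blast
qed

lemma div_gcd_pos: "m > 0 \<Longrightarrow> m div gcd m k > 0" for m k :: nat
  by (simp add: div_greater_zero_iff)

text \<open>The order of a power in a cyclic group: cancel the gcd in \<open>m dvd k * j\<close>,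
  then drop \<open>k div g\<close>, which is coprime to \<open>m div g\<close>.\<close>

lemma primitive_root_power:
  assumes "m > 0" "z \<in> primitive_roots_unity m"
  shows "z ^ k \<in> primitive_roots_unity (m div gcd m k)"
proof -
  define g where "g = gcd m k"
  have g: "g > 0" "g dvd m" "g dvd k" using assms by (auto simp: g_def)
  have pos: "m div g > 0" unfolding g_def using assms by (simp add: div_gcd_pos)
  have cop: "coprime (m div g) (k div g)"
    unfolding g_def using assms by (intro div_gcd_coprime) auto
  have "(z ^ k) ^ j = 1 \<longleftrightarrow> m div g dvd j" for j
  proof -
    have "(z ^ k) ^ j = 1 \<longleftrightarrow> m dvd k * j"
      using assms by (simp add: primitive_roots_unity_iff flip: power_mult)
    also have "\<dots> \<longleftrightarrow> g * (m div g) dvd g * ((k div g) * j)"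
      using g by (simp flip: mult.assoc)
    also have "\<dots> \<longleftrightarrow> m div g dvd (k div g) * j"
      using g by (subst nat_mult_dvd_cancel1) auto
    also have "\<dots> \<longleftrightarrow> m div g dvd j"
      using cop by (simp add: coprime_dvd_mult_right_iff)
    finally show ?thesis .
  qed
  then show ?thesis using pos by (simp add: primitive_roots_unity_iff g_def)
qed

text \<open>Used to lift a unit modulo \<open>n\<close> to a unit modulo \<open>m\<close> without
  changing its residue modulo \<open>n\<close>.\<close>

lemma coprime_lift:
  fixes j m n :: nat
  assumes "m > 0" "coprime j n"
  obtains t where "coprime (j + n * t) m"
proof -
  \<comment> \<open>With this \<open>t\<close>, each prime \<open>p\<close> of \<open>m\<close>
    divides exactly one of \<open>j\<close> and \<open>n * t\<close>: if \<open>p\<close> divides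
    \<open>j\<close>, it divides neither \<open>n\<close> (coprimality) nor \<open>t\<close>;
    otherwise it divides \<open>t\<close>. So it never divides the sum.\<close>
  define t where "t = \<Prod>{p \<in> prime_factors m. \<not> p dvd j}"
  have t: "p dvd t \<longleftrightarrow> \<not> p dvd j" if p: "p \<in> prime_factors m" for p
  proof
    assume "p dvd t"
    moreover have "prime p" using p by auto
    ultimately obtain q where "q \<in> prime_factors m" "\<not> q dvd j" "p dvd q"
      unfolding t_def by (auto simp: prime_dvd_prod_iff)
    then show "\<not> p dvd j"
      using \<open>prime p\<close> by (metis in_prime_factors_imp_prime primes_dvd_imp_eq)
  next
    assume "\<not> p dvd j"
    then show "p dvd t"
      unfolding t_def using p by (intro dvd_prodI[where f = "\<lambda>x. x", simplified]) auto
  qed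
  have "\<not> p dvd j + n * t" if p: "prime p" "p dvd m" for p
  proof -
    have pm: "p \<in> prime_factors m" using p assms by (simp add: in_prime_factors_iff)
    show ?thesis
    proof (cases "p dvd j")
      case True
      then have "\<not> p dvd n" using assms(2) p(1) by (metis coprime_common_divisor not_prime_unit)
      with True t[OF pm] p(1) show ?thesis
        by (simp add: dvd_add_right_iff prime_dvd_mult_iff)
    next
      case False
      with t[OF pm] show ?thesis by (simp add: dvd_add_left_iff)
    qed
  qed
  then have "gcd (j + n * t) m = 1"
    using prime_factor_nat[of "gcd (j + n * t) m"] by auto
  then have "coprime (j + n * t) m" by (simp add: coprime_iff_gcd_eq_1)
  with that show ?thesis by blast
qed

lemma primitive_root_power_surj:
  assumes "m > 0" "w \<in> primitive_roots_unity (m div gcd m k)"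
  obtains z where "z \<in> primitive_roots_unity m" "w = z ^ k"
proof -
  define n where "n = m div gcd m k"
  have n: "n > 0" unfolding n_def using assms by (simp add: div_gcd_pos)
  define z where "z = cis (2 * pi / real m)"
  have z: "z \<in> primitive_roots_unity m"
    unfolding z_def using cis_in_primitive_roots_unity[OF assms(1)] .
  then have zk: "z ^ k \<in> primitive_roots_unity n"
    unfolding n_def using primitive_root_power assms(1) by blast
  have w: "w \<in> primitive_roots_unity n" using assms(2) by (simp add: n_def)
  then have "w ^ n = 1" by (simp add: primitive_roots_unity_def)
  then obtain j where j: "w = (z ^ k) ^ j" using root_unity_eq_power[OF n zk] by blast
  have "w \<in> primitive_roots_unity (n div gcd n j)"
    unfolding j using primitive_root_power[OF n zk] .
  then have "w ^ (n div gcd n j) = 1" by (simp add: primitive_roots_unity_def)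
  \<comment> \<open>Both \<open>n\<close> and \<open>n div gcd n j\<close> are the order of
    \<open>w\<close>, which forces the gcd to be 1.\<close>
  then have "n dvd n div gcd n j" using w n by (simp add: primitive_roots_unity_iff)
  then have "n \<le> n div gcd n j" using n by (intro dvd_imp_le) (simp_all add: div_gcd_pos)
  then have "\<not> gcd n j > 1" using n div_less_dividend[of "gcd n j" n] by linarith
  moreover have "gcd n j > 0" using n by simp
  ultimately have "gcd n j = 1" by linarith
  then have "coprime j n" by (simp add: coprime_iff_gcd_eq_1 gcd.commute)
  then obtain t where t: "coprime (j + n * t) m" using coprime_lift assms(1) by blast
  \<comment> \<open>The shift by \<open>n * t\<close> is invisible after raising to the power
    \<open>k\<close>, since \<open>(z ^ k) ^ n = 1\<close>, while it makes the exponent of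
    \<open>z\<close> coprime to \<open>m\<close>.\<close>
  have "(z ^ (j + n * t)) ^ k = (z ^ k) ^ j * ((z ^ k) ^ n) ^ t"
    by (simp add: algebra_simps flip: power_mult power_add)
  also have "\<dots> = w" using zk j by (simp add: primitive_roots_unity_def)
  finally have "w = (z ^ (j + n * t)) ^ k" ..
  moreover have "z ^ (j + n * t) \<in> primitive_roots_unity m"
    using primitive_root_power[OF assms(1) z, of "j + n * t"] t
    by (simp add: gcd.commute coprime_iff_gcd_eq_1)
  ultimately show ?thesis using that by blast
qed

section \<open>Reduction of necklace polynomials to the squarefree part\<close>

lemma squarefree_dvd_iff_dvd_prod_prime_factors:
  fixes d e :: nat
  assumes "d > 0"
  shows "squarefree e \<and> e dvd d \<longleftrightarrow> e dvd \<Prod>(prime_factors d)"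
proof (cases "e = 0")
  case False
  define c where "c = \<Prod>(prime_factors d)"
  have "c > 0" unfolding c_def by (auto intro!: prod_pos prime_gt_0_nat)
  \<comment> \<open>The exponents in \<open>c\<close> are those in \<open>d\<close> capped at 1,
    which encodes squarefreeness and divisibility at once.\<close>
  have mult: "multiplicity p c = (if multiplicity p d > 0 then 1 else 0)" if "prime p" for p
  proof -
    have "p \<in> prime_factors d \<longleftrightarrow> multiplicity p d > 0"
      using that by (simp add: prime_factors_multiplicity)
    moreover have "multiplicity p c = (if p \<in> prime_factors d then 1 else 0)"
      unfolding c_def using multiplicity_prod_prime_powers[of "prime_factors d" p "\<lambda>_. 1"] that
      by (simp add: in_prime_factors_imp_prime)
    ultimately show ?thesis by simp
  qed
  have "squarefree e \<and> e dvd d \<longleftrightarrow>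
      (\<forall>p. prime p \<longrightarrow> multiplicity p e \<le> 1 \<and> multiplicity p e \<le> multiplicity p d)"
    using False assms by (auto simp: squarefree_factorial_semiring'' prime_multiplicity_le_imp_dvd)
  also have "\<dots> \<longleftrightarrow> (\<forall>p. prime p \<longrightarrow> multiplicity p e \<le> multiplicity p c)"
    by (auto simp: mult)
  also have "\<dots> \<longleftrightarrow> e dvd c"
    using False \<open>c > 0\<close> by (simp add: prime_multiplicity_le_imp_dvd)
  finally show ?thesis by (simp add: c_def)
qed (use assms in auto)

lemma pcompose_power: "pcompose (p ^ n) q = pcompose p q ^ n"
  by (induction n) (simp_all add: pcompose_1 pcompose_mult)

text \<open>The scalar only replaces the normalisation \<open>1 / c\<close> by \<open>1 / d\<close>;
  the sums agree because \<open>d div e = (d div c) * (c div e)\<close> for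
  \<open>e dvd c\<close>.\<close>

lemma necklace_poly_eq_pcompose:
  assumes "d > 0" and c: "c = \<Prod>(prime_factors d)"
  shows "necklace_poly d =
           smult (of_nat c / of_nat d) (pcompose (necklace_poly c) (monom 1 (d div c)))"
proof -
  have iff: "squarefree e \<and> e dvd d \<longleftrightarrow> e dvd c" for e
    unfolding c using squarefree_dvd_iff_dvd_prod_prime_factors[OF assms(1)] .
  have "c dvd d" "c > 0" using iff[of c] assms(1) by (auto intro: dvd_pos_nat)
  have "pcompose (necklace_poly c) (monom 1 (d div c)) =
      smult (1 / of_nat c) (\<Sum>e | e dvd c. smult (of_int (moebius e)) (monom 1 (d div e)))"
  proof -
    have "pcompose (monom 1 (c div e)) (monom 1 (d div c)) = (monom 1 (d div e) :: rat poly)"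
      if "e dvd c" for e
    proof -
      have "d div e = (d div c) * (c div e)"
        using that \<open>c dvd d\<close> \<open>c > 0\<close> by (elim dvdE) auto
      then show ?thesis
        by (simp add: monom_altdef pcompose_smult pcompose_power pcompose_pCons power_mult)
    qed
    then show ?thesis
      by (simp add: necklace_poly_def pcompose_smult pcompose_sum)
  qed
  also have "(\<Sum>e | e dvd c. smult (of_int (moebius e)) (monom 1 (d div e))) =
      (\<Sum>e | e dvd d. smult (of_int (moebius e)) (monom 1 (d div e)) :: rat poly)"
    \<comment> \<open>The additional divisors of \<open>d\<close> are not squarefree, so
      \<open>moebius\<close> is 0 there.\<close>
    using iff assms(1) by (intro sum.mono_neutral_left) (auto simp: moebius_def)
  finally show ?thesis using \<open>c > 0\<close> by (simp add: necklace_poly_def)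
qed

theorem theorem2p9:
  fixes d c m :: nat
  assumes "d \<ge> 1"
    and "c = (\<Prod>p\<in>prime_factors d. p)"
    and "m \<ge> 1"
    and "cyclotomic_poly m dvd necklace_poly d"
  shows "\<exists>n\<ge>1. cyclotomic_poly n dvd necklace_poly c \<and>
           cyclotomic_poly m dvd pcompose (cyclotomic_poly n) (monom 1 (d div c))"
proof (intro exI conjI)
  define k where "k = d div c"
  \<comment> \<open>The common order of all \<open>z ^ k\<close> with \<open>z\<close> a primitive
    \<open>m\<close>-th root of unity.\<close>
  define n where "n = m div gcd m k"
  have m: "m > 0" using assms(3) by simp
  then have n: "n > 0" unfolding n_def by (simp add: div_gcd_pos)
  then show "n \<ge> 1" by simp
  have c: "c > 0" unfolding assms(2) by (auto intro!: prod_pos prime_gt_0_nat)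
  have X: "poly (complex_poly (monom 1 k)) z = z ^ k" for z
    by (simp add: map_poly_monom poly_monom)
  have "cyclotomic_poly m dvd pcompose (necklace_poly c) (monom 1 k)"
  proof -
    have "necklace_poly d = smult (of_nat c / of_nat d) (pcompose (necklace_poly c) (monom 1 k))"
      unfolding k_def using assms(1,2) by (intro necklace_poly_eq_pcompose) auto
    \<comment> \<open>The scalar \<open>c / d\<close> is nonzero, so it does not affect
      divisibility.\<close>
    with assms(1,4) c show ?thesis by (simp add: dvd_smult_iff)
  qed
  then have roots: "poly (complex_poly (necklace_poly c)) (z ^ k) = 0"
    if "z \<in> primitive_roots_unity m" for z
    using that by (simp add: cyclotomic_poly_dvd_iff[OF m] poly_complex_poly_pcompose X)
  show "cyclotomic_poly n dvd necklace_poly c"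
    unfolding cyclotomic_poly_dvd_iff[OF n]
    using roots primitive_root_power_surj[OF m] by (metis n_def)
  \<comment> \<open>The root criterion, applied to the divisibility of
    \<open>cyclotomic_poly n\<close> by itself.\<close>
  have "poly (complex_poly (cyclotomic_poly n)) w = 0" if "w \<in> primitive_roots_unity n" for w
    using that cyclotomic_poly_dvd_iff[OF n, of "cyclotomic_poly n"] by simp
  then show "cyclotomic_poly m dvd pcompose (cyclotomic_poly n) (monom 1 (d div c))"
    unfolding cyclotomic_poly_dvd_iff[OF m] poly_complex_poly_pcompose X[unfolded k_def]
    using primitive_root_power[OF m] by (auto simp: n_def k_def)
qed

end
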